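(* Consider the system $\dot x=f(t,x)$, $t\ge t_0$, on $\mathbb{R}^n$, with $f(t,x)$ piecewise continuous in $t$, continuously differentiable in $x$, and forward complete, and let $K\subset\mathbb{R}^n$ be a compact set with nonempty interior. Then the topological entropy satisfies $$h(f,t_0,K)=h\big(f,t_1,\xi(t_1,t_0,K)\big)\qquad\text{for all } t_1\ge t_0.$$
   Context: $\xi(t,t_0,x)$ denotes the solution at time $t$ with state $x$ at time $t_0$, and $\xi(t,t_0,K):=\{\xi(t,t_0,x):x\in K\}$ is the reachable set. Topological entropy (for an initial time $s$ and a compact initial set $L\subset\mathbb{R}^n$ with nonempty interior): fix a norm $|\cdot|$ on $\mathbb{R}^n$ (the entropy does not depend on this choice). For $T\ge0$, $\varepsilon>0$, let $B_{f,s}(x,\varepsilon,T):=\{\bar x\in\mathbb{R}^n:\max_{t\in[s,s+T]}|\xi(t,s,\bar x)-\xi(t,s,x)|<\varepsilon\}$. A subset $E\subset L$ is $(T,\varepsilon)$-spanning for $L$ at $s$ if $L\subset\bigcup_{x\in E}B_{f,s}(x,\varepsilon,T)$; $S(f,s,\varepsilon,T,L)$ is the minimal cardinality of such a set. Then $h(f,s,L):=\lim_{\varepsilon\searrow0}\limsup_{T\to\infty}\frac1T\log S(f,s,\varepsilon,T,L)$ (natural logarithm).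
   Formalization: "Continuously differentiable in x" is taken to include that the Jacobian in x is bounded on compact sets of times and states; without such uniformity in t, solutions need not be unique, so ξ would be undefined. *)

theory Defs
  imports "HOL-Analysis.Analysis"
begin

definition is_norm :: "(real ^ 'n \<Rightarrow> real) \<Rightarrow> bool" where
  "is_norm N \<longleftrightarrow>
     (\<forall>x. N x = 0 \<longleftrightarrow> x = 0) \<and>
     (\<forall>c x. N (c *\<^sub>R x) = \<bar>c\<bar> * N x) \<and>
     (\<forall>x y. N (x + y) \<le> N x + N y)"

text \<open>Piecewise continuity on \<open>{t0..}\<close> means finitely many discontinuities in every bounded
  interval, all of them finite jumps.\<close>

definition piecewise_continuous_from :: "real \<Rightarrow> (real \<Rightarrow> 'a::t2_space) \<Rightarrow> bool" where
  "piecewise_continuous_from t0 g \<longleftrightarrow>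
     (\<forall>b. finite {t \<in> {t0..b}. \<not> continuous (at t within {t0..}) g}) \<and>
     (\<forall>t\<ge>t0. \<exists>l. (g \<longlongrightarrow> l) (at_right t)) \<and>
     (\<forall>t>t0. \<exists>l. (g \<longlongrightarrow> l) (at_left t))"

text \<open>The discontinuity times may depend on the state. This is weaker than asking for one
  common exceptional set of times.\<close>

definition piecewise_continuous_in_time :: "real \<Rightarrow> (real \<Rightarrow> real ^ 'n \<Rightarrow> real ^ 'n) \<Rightarrow> bool" where
  "piecewise_continuous_in_time t0 f \<longleftrightarrow> (\<forall>x. piecewise_continuous_from t0 (\<lambda>t. f t x))"

text \<open>The last conjunct bounds the Jacobian on compact sets of times and states, i.e. it gives
  the usual local Lipschitz condition in the state, locally uniform in time. It holds whenever
  the Jacobian is jointly piecewise continuous. It cannot be dropped, since differentiability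
  of each \<open>f t\<close> separately does not make solutions unique: with \<open>g\<close> smooth and bounded,
  \<open>g y = 2 * y\<close> for \<open>\<bar>y\<bar> \<le> 1\<close>, the field \<open>f t x = t * g (x / t^2)\<close>, \<open>f 0 x = 0\<close>, has all the
  solutions \<open>c * t^2\<close> with \<open>\<bar>c\<bar> \<le> 1\<close>.\<close>

definition continuously_differentiable_in_state ::
    "real \<Rightarrow> (real \<Rightarrow> real ^ 'n \<Rightarrow> real ^ 'n) \<Rightarrow> bool" where
  "continuously_differentiable_in_state t0 f \<longleftrightarrow>
     (\<exists>J :: real \<Rightarrow> real ^ 'n \<Rightarrow> ((real ^ 'n) \<Rightarrow>\<^sub>L (real ^ 'n)).
        (\<forall>t\<ge>t0. (\<forall>x. (f t has_derivative blinfun_apply (J t x)) (at x)) \<and>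
                 continuous_on UNIV (J t)) \<and>
        (\<forall>b C. compact C \<longrightarrow> bounded (\<Union>t\<in>{t0..b}. J t ` C)))"

text \<open>Solutions are meant in the integral (Caratheodory) sense, as the right-hand side is
  discontinuous in time. The condition at \<open>t = s\<close> is \<open>\<phi> s = x\<close>, and continuity of \<open>\<phi>\<close> on
  \<open>{s..}\<close> is implied.\<close>

definition solution_from ::
    "(real \<Rightarrow> real ^ 'n \<Rightarrow> real ^ 'n) \<Rightarrow> real \<Rightarrow> real ^ 'n \<Rightarrow> (real \<Rightarrow> real ^ 'n) \<Rightarrow> bool" where
  "solution_from f s x \<phi> \<longleftrightarrow>
     (\<forall>t\<ge>s. ((\<lambda>r. f r (\<phi> r)) has_integral (\<phi> t - x)) {s..t})"

definition forward_complete :: "real \<Rightarrow> (real \<Rightarrow> real ^ 'n \<Rightarrow> real ^ 'n) \<Rightarrow> bool" where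
  "forward_complete t0 f \<longleftrightarrow> (\<forall>s\<ge>t0. \<forall>x. \<exists>\<phi>. solution_from f s x \<phi>)"

text \<open>\<open>flow f t s x\<close> is the state at time \<open>t\<close> of the solution with state \<open>x\<close> at time \<open>s\<close>;
  only \<open>t \<ge> s\<close> is meaningful.\<close>

definition flow :: "(real \<Rightarrow> real ^ 'n \<Rightarrow> real ^ 'n) \<Rightarrow> real \<Rightarrow> real \<Rightarrow> real ^ 'n \<Rightarrow> real ^ 'n" where
  "flow f t s x = (THE y. \<exists>\<phi>. solution_from f s x \<phi> \<and> \<phi> t = y)"

definition reachable_set ::
    "(real \<Rightarrow> real ^ 'n \<Rightarrow> real ^ 'n) \<Rightarrow> real \<Rightarrow> real \<Rightarrow> (real ^ 'n) set \<Rightarrow> (real ^ 'n) set" where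
  "reachable_set f t s K = flow f t s ` K"

text \<open>The supremum is a maximum, as trajectories are continuous.\<close>

definition bowen_ball ::
    "(real ^ 'n \<Rightarrow> real) \<Rightarrow> (real \<Rightarrow> real ^ 'n \<Rightarrow> real ^ 'n) \<Rightarrow> real \<Rightarrow> real ^ 'n \<Rightarrow> real \<Rightarrow> real \<Rightarrow>
     (real ^ 'n) set" where
  "bowen_ball N f s x \<epsilon> T = {y. (SUP t\<in>{s..s+T}. N (flow f t s y - flow f t s x)) < \<epsilon>}"

definition spanning_set ::
    "(real ^ 'n \<Rightarrow> real) \<Rightarrow> (real \<Rightarrow> real ^ 'n \<Rightarrow> real ^ 'n) \<Rightarrow> real \<Rightarrow> real \<Rightarrow> real \<Rightarrow>
     (real ^ 'n) set \<Rightarrow> (real ^ 'n) set \<Rightarrow> bool" where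
  "spanning_set N f s \<epsilon> T L E \<longleftrightarrow> E \<subseteq> L \<and> L \<subseteq> (\<Union>x\<in>E. bowen_ball N f s x \<epsilon> T)"

text \<open>For compact \<open>L\<close>, \<open>\<epsilon> > 0\<close> and \<open>T \<ge> 0\<close> a finite spanning set exists by continuous dependence
  on the initial state, so the minimum is over a nonempty set.\<close>

definition min_spanning_card ::
    "(real ^ 'n \<Rightarrow> real) \<Rightarrow> (real \<Rightarrow> real ^ 'n \<Rightarrow> real ^ 'n) \<Rightarrow> real \<Rightarrow> real \<Rightarrow> real \<Rightarrow>
     (real ^ 'n) set \<Rightarrow> nat" where
  "min_spanning_card N f s \<epsilon> T L =
     (LEAST k. \<exists>E. finite E \<and> card E = k \<and> spanning_set N f s \<epsilon> T L E)"

text \<open>The entropy may be infinite, hence the extended reals. The limit in \<open>\<epsilon>\<close> exists by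
  monotonicity.\<close>

definition topological_entropy ::
    "(real ^ 'n \<Rightarrow> real) \<Rightarrow> (real \<Rightarrow> real ^ 'n \<Rightarrow> real ^ 'n) \<Rightarrow> real \<Rightarrow> (real ^ 'n) set \<Rightarrow> ereal" where
  "topological_entropy N f s L =
     Lim (at_right (0::real))
       (\<lambda>\<epsilon>. Limsup at_top
          (\<lambda>T::real. ereal (1 / T * ln (real (min_spanning_card N f s \<epsilon> T L)))))"

end

theory Submission
  imports Defs
begin

text \<open>Write \<open>S\<^sub>0\<close> and \<open>S\<^sub>1\<close> for the minimal cardinalities at \<open>(t0, K)\<close> and at
  \<open>(t1, \<xi>(t1, t0, K))\<close>. Pushing a spanning set forward to time \<open>t1\<close> gives
  \<open>S\<^sub>1(\<epsilon>, T) \<le> S\<^sub>0(\<epsilon>, T + t1 - t0)\<close>, and the time shift disappears in the exponential growth rate.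
  Conversely, all trajectories from \<open>K\<close> stay in a bounded set during \<open>[t0, t1]\<close>, so Gronwall's
  inequality run backwards bounds their distances on \<open>[t0, t1]\<close> by a constant \<open>A\<close> times the
  distance at \<open>t1\<close>; pulling a spanning set back gives \<open>S\<^sub>0(\<epsilon>, T) \<le> S\<^sub>1(\<epsilon> / A, T)\<close>, and the factor
  \<open>A\<close> disappears in the limit \<open>\<epsilon> \<rightarrow> 0\<close>.\<close>

section \<open>Gronwall's inequality\<close>

text \<open>The right-hand side \<open>v\<close> times the integrating factor
  \<open>exp (- (M * (r - a)))\<close> has derivative \<open>(M * u r - M * v r)\<close> times a
  positive factor. This is nonpositive by hypothesis, so \<open>w\<close> stays below
  \<open>w a = c\<close>.\<close>

lemma gronwall:
  fixes u :: "real \<Rightarrow> real"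
  assumes cont: "continuous_on {a..b} u"
    and le: "\<And>t. t \<in> {a..b} \<Longrightarrow> u t \<le> c + M * integral {a..t} u"
    and M: "M \<ge> 0" and t: "t \<in> {a..b}"
  shows "u t \<le> c * exp (M * (t - a))"
proof -
  define v where "v r = c + M * integral {a..r} u" for r
  define w where "w r = v r * exp (- (M * (r - a)))" for r
  have dI: "((\<lambda>r. integral {a..r} u) has_real_derivative u r) (at r within {a..b})"
    if "r \<in> {a..b}" for r
    using integral_has_vector_derivative[OF cont that]
    by (simp add: has_real_derivative_iff_has_vector_derivative)
  have dw: "(w has_real_derivative (M * u r - M * v r) * exp (- (M * (r - a)))) (at r within {a..b})"
    if "r \<in> {a..b}" for r
    unfolding w_def v_def
    by (auto intro!: derivative_eq_intros dI that simp: algebra_simps)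
  have "w t \<le> w a"
  proof (rule DERIV_nonpos_imp_decreasing_open[of a t w])
    show "a \<le> t" using t by simp
    fix r assume r: "a < r" "r < t"
    then have "r \<in> {a..b}" "at r within {a..b} = at r" using t at_within_Icc_at[of a r b] by auto
    moreover have "M * u r \<le> M * v r"
      using le[of r] r t M by (intro mult_left_mono) (auto simp: v_def)
    then have "(M * u r - M * v r) * exp (- (M * (r - a))) \<le> 0"
      by (intro mult_nonpos_nonneg) auto
    ultimately show "\<exists>y. (w has_real_derivative y) (at r) \<and> y \<le> 0"
      using dw[of r] by auto
  next
    have "continuous_on {a..b} w"
      by (rule DERIV_continuous_on) (rule dw)
    then show "continuous_on {a..t} w" using t by (auto elim: continuous_on_subset)
  qed
  then have "v t * exp (- (M * (t - a))) \<le> c"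
    by (simp add: w_def v_def)
  then have "v t \<le> c * exp (M * (t - a))"
    by (simp only: exp_minus divide_inverse[symmetric] pos_divide_le_eq exp_gt_zero)
  with le[OF t] show ?thesis by (simp add: v_def)
qed

text \<open>Time reversal \<open>r \<mapsto> - r\<close> reduces this to \<open>gronwall\<close> on
  \<open>{- b..- a}\<close>.\<close>

lemma gronwall_backward:
  fixes u :: "real \<Rightarrow> real"
  assumes cont: "continuous_on {a..b} u"
    and le: "\<And>t. t \<in> {a..b} \<Longrightarrow> u t \<le> c + M * integral {t..b} u"
    and M: "M \<ge> 0" and t: "t \<in> {a..b}"
  shows "u t \<le> c * exp (M * (b - t))"
proof -
  have "u (- (- t)) \<le> c * exp (M * (- t - (- b)))"
  proof (rule gronwall[where b = "- a" and u = "\<lambda>r. u (- r)"])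
    show "continuous_on {- b..- a} (\<lambda>r. u (- r))"
      by (rule continuous_on_compose2[OF cont]) (auto intro!: continuous_intros)
    show "u (- r) \<le> c + M * integral {- b..r} (\<lambda>r. u (- r))" if "r \<in> {- b..- a}" for r
      using le[of "- r"] that Henstock_Kurzweil_Integration.integral_reflect_real[of b "- r" u] by auto
  qed (use M t in auto)
  then show ?thesis by simp
qed

section \<open>Norms\<close>

text \<open>Equivalence of norms in finite dimension. Expanding in the standard basis gives the
  upper constant; this makes \<open>N\<close> Lipschitz, hence continuous, and its positive minimum
  on the compact unit sphere is the lower constant.\<close>

lemma is_norm_bounds:
  fixes N :: "real ^ 'n \<Rightarrow> real"
  assumes "is_norm N"
  obtains c C where "c > 0" "C > 0" "\<And>x. c * norm x \<le> N x" "\<And>x. N x \<le> C * norm x"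
    "continuous_on UNIV N"
proof -
  have zero: "N x = 0 \<longleftrightarrow> x = 0" and scale: "N (a *\<^sub>R x) = \<bar>a\<bar> * N x"
    and tri: "N (x + y) \<le> N x + N y" for x y a
    using assms by (auto simp: is_norm_def)
  have minus: "N (- x) = N x" for x using scale[of "-1" x] by simp
  have nonneg: "N x \<ge> 0" for x using tri[of x "- x"] minus[of x] zero[THEN iffD2, OF refl] by simp
  define C where "C = (\<Sum>i\<in>Basis. N i) + 1"
  have "C > 0" unfolding C_def using nonneg by (simp add: add_nonneg_pos sum_nonneg)
  have sum: "N (\<Sum>i\<in>A. g i) \<le> (\<Sum>i\<in>A. N (g i))" if "finite A" for A and g :: "real ^ 'n \<Rightarrow> real ^ 'n"
    using that
  proof induction
    case empty
    then show ?case using zero[THEN iffD2, OF refl] by simp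
  next
    case (insert a A)
    then show ?case using tri[of "g a" "\<Sum>i\<in>A. g i"] by simp
  qed
  have upper: "N x \<le> C * norm x" for x
  proof -
    have "N x = N (\<Sum>i\<in>Basis. (x \<bullet> i) *\<^sub>R i)" by (simp add: euclidean_representation)
    also have "\<dots> \<le> (\<Sum>i\<in>Basis. \<bar>x \<bullet> i\<bar> * N i)"
      using sum[of Basis "\<lambda>i. (x \<bullet> i) *\<^sub>R i"] by (simp add: scale)
    also have "\<dots> \<le> (\<Sum>i\<in>Basis. norm x * N i)"
      by (intro sum_mono mult_right_mono nonneg) (auto simp: Basis_le_norm)
    also have "\<dots> \<le> C * norm x"
      by (simp add: C_def sum_distrib_left distrib_left mult.commute)
    finally show ?thesis .
  qed
  have "C-lipschitz_on UNIV N"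
  proof (rule lipschitz_onI)
    show "dist (N x) (N y) \<le> C * dist x y" for x y
      using tri[of y "x - y"] tri[of x "y - x"] upper[of "x - y"] minus[of "x - y"]
      by (auto simp: dist_norm abs_if)
  qed (use \<open>C > 0\<close> in simp)
  then have cont: "continuous_on UNIV N" by (rule lipschitz_on_continuous_on)
  have "sphere (0 :: real ^ 'n) 1 \<noteq> {}" by (simp add: sphere_eq_empty)
  then obtain z where z: "z \<in> sphere 0 1" "\<And>x. x \<in> sphere 0 1 \<Longrightarrow> N z \<le> N x"
    using continuous_attains_inf[of "sphere 0 1" N] continuous_on_subset[OF cont] by auto
  have "N z > 0" using z(1) nonneg[of z] zero[of z] by (auto simp: less_le)
  moreover have "N z * norm x \<le> N x" for x
  proof (cases "x = 0")
    case True
    then show ?thesis using zero[THEN iffD2, OF refl] by simp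
  next
    case False
    then have "N z \<le> N ((1 / norm x) *\<^sub>R x)" by (intro z(2)) simp
    then show ?thesis using False by (simp add: scale field_simps)
  qed
  ultimately show thesis using that \<open>C > 0\<close> upper cont by blast
qed

section \<open>Solutions\<close>

text \<open>At \<open>t = s\<close> the integral runs over a degenerate interval and vanishes, so
  the integral equation contains the initial condition.\<close>

lemma solution_from_initial: "solution_from f s x \<phi> \<Longrightarrow> \<phi> s = x"
  unfolding solution_from_def
  using has_integral_unique[OF _ has_integral_refl(2)] by fastforce

lemma solution_from_continuous_on:
  assumes "solution_from f s x \<phi>"
  shows "continuous_on {s..b} \<phi>"
proof (cases "s \<le> b")
  case True
  let ?g = "\<lambda>r. f r (\<phi> r)"
  have "?g integrable_on {s..b}" using assms True by (auto simp: solution_from_def)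
  then have "continuous_on {s..b} (\<lambda>t. x + integral {s..t} ?g)"
    by (intro continuous_intros indefinite_integral_continuous_1)
  then show ?thesis
  proof (rule continuous_on_eq)
    show "x + integral {s..t} ?g = \<phi> t" if "t \<in> {s..b}" for t
      using assms that by (auto simp: solution_from_def dest!: integral_unique)
  qed
qed simp

lemma solution_from_has_integral:
  assumes "solution_from f s x \<phi>" "s \<le> r" "r \<le> t"
  shows "((\<lambda>q. f q (\<phi> q)) has_integral (\<phi> t - \<phi> r)) {r..t}"
proof -
  let ?g = "\<lambda>q. f q (\<phi> q)"
  have 1: "(?g has_integral (\<phi> t - x)) {s..t}" and 2: "(?g has_integral (\<phi> r - x)) {s..r}"
    using assms by (auto simp: solution_from_def)
  have int: "?g integrable_on {r..t}"
    by (rule integrable_on_subinterval[OF has_integral_integrable[OF 1]]) (use assms in auto)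
  have "integral {s..r} ?g + integral {r..t} ?g = integral {s..t} ?g"
    by (rule Henstock_Kurzweil_Integration.integral_combine) (use assms 1 in auto)
  then have "integral {r..t} ?g = \<phi> t - \<phi> r"
    using integral_unique[OF 1] integral_unique[OF 2] by (simp add: algebra_simps)
  then show ?thesis using integrable_integral[OF int] by simp
qed

lemma solution_from_later:
  "solution_from f s x \<phi> \<Longrightarrow> s \<le> r \<Longrightarrow> solution_from f r (\<phi> r) \<phi>"
  using solution_from_has_integral[of f s x \<phi> r] by (simp add: solution_from_def[of f r])

text \<open>Both endpoints \<open>r\<close> and \<open>t\<close> are left free: fixing
  \<open>r = s\<close> feeds the forward Gronwall inequality, fixing \<open>t = b\<close> the
  backward one. The set \<open>X\<close> confines both trajectories to where the Lipschitz constant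
  is valid.\<close>

lemma solution_from_increment:
  assumes \<phi>: "solution_from f s x \<phi>" and \<psi>: "solution_from f s y \<psi>"
    and lip: "\<And>t x y. t \<in> {s..b} \<Longrightarrow> x \<in> X \<Longrightarrow> y \<in> X \<Longrightarrow> norm (f t x - f t y) \<le> M * norm (x - y)"
    and X: "\<phi> ` {s..b} \<subseteq> X" "\<psi> ` {s..b} \<subseteq> X"
    and r: "s \<le> r" "r \<le> t" "t \<le> b"
  shows "norm ((\<psi> t - \<phi> t) - (\<psi> r - \<phi> r)) \<le> M * integral {r..t} (\<lambda>q. norm (\<psi> q - \<phi> q))"
proof -
  have int: "((\<lambda>q. f q (\<psi> q) - f q (\<phi> q)) has_integral ((\<psi> t - \<psi> r) - (\<phi> t - \<phi> r))) {r..t}"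
    using solution_from_has_integral[OF \<psi> r(1,2)] solution_from_has_integral[OF \<phi> r(1,2)]
    by (rule has_integral_diff)
  have "continuous_on {s..b} (\<lambda>q. M * norm (\<psi> q - \<phi> q))"
    using \<phi> \<psi> by (intro continuous_intros solution_from_continuous_on)
  then have "continuous_on {r..t} (\<lambda>q. M * norm (\<psi> q - \<phi> q))"
    by (rule continuous_on_subset) (use r in auto)
  then have "norm (integral {r..t} (\<lambda>q. f q (\<psi> q) - f q (\<phi> q)))
      \<le> integral {r..t} (\<lambda>q. M * norm (\<psi> q - \<phi> q))"
    using r X
    by (intro integral_norm_bound_integral has_integral_integrable[OF int] integrable_continuous_real lip)
      (auto simp: image_subset_iff)
  then show ?thesis using integral_unique[OF int] by (simp add: algebra_simps)
qed

lemma solution_from_distance: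
  assumes \<phi>: "solution_from f s x \<phi>" and \<psi>: "solution_from f s y \<psi>"
    and lip: "\<And>t x y. t \<in> {s..b} \<Longrightarrow> x \<in> X \<Longrightarrow> y \<in> X \<Longrightarrow> norm (f t x - f t y) \<le> M * norm (x - y)"
    and X: "\<phi> ` {s..b} \<subseteq> X" "\<psi> ` {s..b} \<subseteq> X"
    and M: "M \<ge> 0" and t: "t \<in> {s..b}"
  shows "norm (\<psi> t - \<phi> t) \<le> norm (y - x) * exp (M * (t - s))"
    and "norm (\<psi> t - \<phi> t) \<le> norm (\<psi> b - \<phi> b) * exp (M * (b - t))"
proof -
  note increment = solution_from_increment[OF \<phi> \<psi> lip X]
  have cont: "continuous_on {s..b} (\<lambda>q. norm (\<psi> q - \<phi> q))"
    using \<phi> \<psi> by (intro continuous_intros solution_from_continuous_on)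
  show "norm (\<psi> t - \<phi> t) \<le> norm (y - x) * exp (M * (t - s))"
  proof (rule gronwall[OF cont _ M t])
    fix r assume "r \<in> {s..b}"
    then show "norm (\<psi> r - \<phi> r) \<le> norm (y - x) + M * integral {s..r} (\<lambda>q. norm (\<psi> q - \<phi> q))"
      using increment[of s r] norm_triangle_sub[of "\<psi> r - \<phi> r" "\<psi> s - \<phi> s"]
        solution_from_initial[OF \<phi>] solution_from_initial[OF \<psi>] by force
  qed
  show "norm (\<psi> t - \<phi> t) \<le> norm (\<psi> b - \<phi> b) * exp (M * (b - t))"
  proof (rule gronwall_backward[OF cont _ M t])
    fix r assume "r \<in> {s..b}"
    then show "norm (\<psi> r - \<phi> r) \<le> norm (\<psi> b - \<phi> b) + M * integral {r..b} (\<lambda>q. norm (\<psi> q - \<phi> q))"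
      using increment[of r b] norm_triangle_sub[of "\<psi> r - \<phi> r" "\<psi> b - \<phi> b"]
      by (force simp: norm_minus_commute)
  qed
qed

section \<open>Local Lipschitz bounds, uniqueness of solutions and the flow\<close>

locale forward_complete_system =
  fixes f :: "real \<Rightarrow> real ^ 'n \<Rightarrow> real ^ 'n" and t0 :: real
  assumes C1: "continuously_differentiable_in_state t0 f"
    and complete: "forward_complete t0 f"
begin

text \<open>Mean value inequality on a convex ball, with the Jacobian bounded uniformly over times
  in \<open>{t0..b}\<close>.\<close>

lemma lipschitz_on_cball:
  obtains M where "M \<ge> 0"
    "\<And>t x y. t \<in> {t0..b} \<Longrightarrow> x \<in> cball 0 R \<Longrightarrow> y \<in> cball 0 R \<Longrightarrow>
      norm (f t x - f t y) \<le> M * norm (x - y)"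
proof -
  obtain J :: "real \<Rightarrow> real ^ 'n \<Rightarrow> (real ^ 'n) \<Rightarrow>\<^sub>L (real ^ 'n)"
    where J: "\<And>t x. t \<ge> t0 \<Longrightarrow> (f t has_derivative blinfun_apply (J t x)) (at x)"
      and bounded: "bounded (\<Union>t\<in>{t0..b}. J t ` cball 0 R)"
    using C1 unfolding continuously_differentiable_in_state_def by (metis compact_cball)
  from bounded obtain M where M: "M > 0" "\<And>t x. t \<in> {t0..b} \<Longrightarrow> x \<in> cball 0 R \<Longrightarrow> norm (J t x) \<le> M"
    unfolding bounded_pos by blast
  show thesis
  proof
    fix t x y assume *: "t \<in> {t0..b}" "x \<in> cball (0 :: real ^ 'n) R" "y \<in> cball (0 :: real ^ 'n) R"
    show "norm (f t x - f t y) \<le> M * norm (x - y)"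
    proof (rule differentiable_bound[of "cball 0 R" "f t" "\<lambda>z. blinfun_apply (J t z)"])
      show "onorm (blinfun_apply (J t z)) \<le> M" if "z \<in> cball 0 R" for z
        using M(2)[OF *(1) that] by (simp add: norm_blinfun.rep_eq)
    qed (use * J in \<open>auto intro: has_derivative_at_withinI\<close>)
  qed (use M in simp)
qed

text \<open>The Lipschitz constant is only available near the trajectory \<open>\<phi>\<close>, so
  Gronwall is combined with a bootstrap: a solution starting close enough cannot leave the tube of
  radius 1 around \<open>\<phi>\<close>. The estimate covers every solution \<open>\<psi>\<close>,
  so that uniqueness can be deduced from it.\<close>

lemma continuous_dependence:
  assumes s: "t0 \<le> s" and \<phi>: "solution_from f s x \<phi>"
  obtains d A where "d > 0" "A > 0"
    "\<And>y \<psi> t. solution_from f s y \<psi> \<Longrightarrow> norm (y - x) < d \<Longrightarrow> t \<in> {s..b} \<Longrightarrow>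
      norm (\<psi> t - \<phi> t) \<le> A * norm (y - x)"
proof -
  have "bounded (\<phi> ` {s..b})"
    by (intro compact_imp_bounded compact_continuous_image solution_from_continuous_on[OF \<phi>]) auto
  then obtain R where R: "\<And>t. t \<in> {s..b} \<Longrightarrow> norm (\<phi> t) \<le> R"
    unfolding bounded_iff by (metis imageI)
  \<comment> \<open>Radius \<open>R + 1\<close> contains the unit tube around
    \<open>\<phi>\<close>.\<close>
  obtain M where M: "M \<ge> 0"
    and lip: "\<And>t x y. t \<in> {t0..b} \<Longrightarrow> x \<in> cball 0 (R + 1) \<Longrightarrow> y \<in> cball 0 (R + 1) \<Longrightarrow>
      norm (f t x - f t y) \<le> M * norm (x - y)"
    using lipschitz_on_cball[of b "R + 1"] by blast
  \<comment> \<open>The absolute value keeps \<open>A \<ge> 1\<close> when \<open>b < s\<close>,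
    where \<open>{s..b}\<close> is empty.\<close>
  define A where "A = exp (M * \<bar>b - s\<bar>)"
  have "A \<ge> 1" using M by (simp add: A_def)
  show thesis
  proof (rule that[of "1 / A" A])
    fix y \<psi> t
    assume \<psi>: "solution_from f s y \<psi>" and y: "norm (y - x) < 1 / A" and t: "t \<in> {s..b}"
    define D where "D r = norm (\<psi> r - \<phi> r)" for r
    have D0: "D s = norm (y - x)"
      by (simp add: D_def solution_from_initial[OF \<phi>] solution_from_initial[OF \<psi>])
    have "1 / A \<le> 1" using \<open>A \<ge> 1\<close> by simp
    with y have "D s < 1" by (simp add: D0)
    have contD: "continuous_on {s..b} D"
      unfolding D_def using \<phi> \<psi> by (intro continuous_intros solution_from_continuous_on)
    have bound: "D r \<le> A * norm (y - x)"
      if r: "r \<in> {s..b}" and small: "\<And>q. q \<in> {s..r} \<Longrightarrow> D q \<le> 1" for r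
    proof -
      have "norm (\<psi> r - \<phi> r) \<le> norm (y - x) * exp (M * (r - s))"
      proof (rule solution_from_distance(1)[OF \<phi> \<psi>, of r "cball 0 (R + 1)"])
        show "\<phi> ` {s..r} \<subseteq> cball 0 (R + 1)"
          using R r by fastforce
        have "norm (\<psi> q) \<le> R + 1" if "q \<in> {s..r}" for q
          using R[of q] small[OF that] norm_triangle_sub[of "\<psi> q" "\<phi> q"] that r
          by (auto simp: D_def)
        then show "\<psi> ` {s..r} \<subseteq> cball 0 (R + 1)" by auto
      qed (use lip M r s in auto)
      also have "\<dots> \<le> norm (y - x) * A"
        unfolding A_def using r M by (intro mult_left_mono) (auto intro: mult_left_mono)
      finally show ?thesis by (simp add: D_def mult.commute)
    qed
    \<comment> \<open>Otherwise there is a first time \<open>r\<close> with \<open>D r = 1\<close>,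
      as the level set is compact and, by the intermediate value theorem, nonempty. The same theorem
      shows \<open>D \<le> 1\<close> up to \<open>r\<close>, so \<open>bound\<close> applies there
      and gives \<open>D r \<le> A * norm (y - x) < 1\<close>, a contradiction.\<close>
    have small: "D q < 1" if "q \<in> {s..b}" for q
    proof (rule ccontr)
      assume "\<not> D q < 1"
      let ?B = "{r \<in> {s..b}. D r = 1}"
      have "\<exists>r\<ge>s. r \<le> q \<and> D r = 1"
        by (rule IVT') (use \<open>D s < 1\<close> \<open>\<not> D q < 1\<close> that contD in \<open>auto elim: continuous_on_subset\<close>)
      then have "?B \<noteq> {}" using that by fastforce
      moreover have "compact ?B"
      proof -
        have "closed ({s..b} \<inter> D -` {1})"
          by (intro continuous_closed_preimage contD) auto
        moreover have "?B = {s..b} \<inter> ({s..b} \<inter> D -` {1})" by auto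
        ultimately show ?thesis by (metis compact_Icc compact_Int_closed)
      qed
      ultimately obtain r where r: "r \<in> ?B" "\<And>r'. r' \<in> ?B \<Longrightarrow> r \<le> r'"
        using compact_attains_inf[of ?B] by blast
      have "D p \<le> 1" if "p \<in> {s..r}" for p
      proof (rule ccontr)
        assume "\<not> D p \<le> 1"
        have "\<exists>r'\<ge>s. r' \<le> p \<and> D r' = 1"
          by (rule IVT') (use \<open>D s < 1\<close> \<open>\<not> D p \<le> 1\<close> that r contD in \<open>auto elim: continuous_on_subset\<close>)
        then obtain r' where r': "s \<le> r'" "r' \<le> p" "D r' = 1" by blast
        with r(2)[of r'] that r(1) have "r \<le> r'" by auto
        with r' that have "p = r'" by auto
        with r' \<open>\<not> D p \<le> 1\<close> show False by simp
      qed
      then have "D r \<le> A * norm (y - x)" using r by (intro bound) auto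
      also have "\<dots> < 1" using y \<open>A \<ge> 1\<close> by (simp add: field_simps)
      finally show False using r by simp
    qed
    then show "norm (\<psi> t - \<phi> t) \<le> A * norm (y - x)"
      using bound[OF t] t unfolding D_def by fastforce
  qed (use \<open>A \<ge> 1\<close> in auto)
qed

text \<open>Continuous dependence with equal initial states: the bound becomes
  \<open>A * 0\<close>.\<close>

lemma solution_unique:
  assumes "t0 \<le> s" "solution_from f s x \<phi>" "solution_from f s x \<psi>" "s \<le> t"
  shows "\<psi> t = \<phi> t"
  using continuous_dependence[OF assms(1,2), of t] assms(3,4)
  by (metis atLeastAtMost_iff eq_iff_diff_eq_0 mult_zero_right norm_le_zero_iff norm_zero order_refl)

lemma flow_eq:
  assumes "t0 \<le> s" "solution_from f s x \<phi>" "s \<le> t"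
  shows "flow f t s x = \<phi> t"
  unfolding flow_def
  by (rule the_equality) (use assms solution_unique in blast)+

lemma solution_flow:
  assumes "t0 \<le> s"
  shows "solution_from f s x (\<lambda>t. flow f t s x)"
proof -
  obtain \<phi> where \<phi>: "solution_from f s x \<phi>"
    using complete assms by (auto simp: forward_complete_def)
  have eq: "flow f r s x = \<phi> r" if "s \<le> r" for r using flow_eq assms \<phi> that by blast
  show ?thesis
    unfolding solution_from_def
  proof (intro allI impI)
    fix t assume t: "s \<le> t"
    then have "((\<lambda>r. f r (\<phi> r)) has_integral (\<phi> t - x)) {s..t}"
      using \<phi> by (auto simp: solution_from_def)
    then show "((\<lambda>r. f r (flow f r s x)) has_integral (flow f t s x - x)) {s..t}"
      using eq t has_integral_cong[of "{s..t}" "\<lambda>r. f r (flow f r s x)" "\<lambda>r. f r (\<phi> r)"] by simp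
  qed
qed

text \<open>Cocycle property: the solution from \<open>s\<close> is also the solution from
  \<open>r\<close> through its own state at \<open>r\<close>.\<close>

lemma flow_flow:
  assumes "t0 \<le> s" "s \<le> r" "r \<le> t"
  shows "flow f t r (flow f r s x) = flow f t s x"
  using assms flow_eq[OF _ solution_from_later[OF solution_flow]] by simp

lemma flow_continuous_on: "t0 \<le> s \<Longrightarrow> continuous_on {s..b} (\<lambda>t. flow f t s x)"
  using solution_from_continuous_on[OF solution_flow] by blast

end

section \<open>Spanning sets\<close>

locale normed_forward_complete_system = forward_complete_system f t0
  for f :: "real \<Rightarrow> real ^ 'n \<Rightarrow> real ^ 'n" and t0 :: real +
  fixes N :: "real ^ 'n \<Rightarrow> real"
  assumes norm_N: "is_norm N"
begin

text \<open>The interval is compact, and nonempty by \<open>0 \<le> T\<close>, so the supremum is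
  attained; this lets the strict inequality pass from the pointwise form to the supremum.\<close>

lemma mem_bowen_ball_iff:
  assumes "t0 \<le> s" "0 \<le> T"
  shows "y \<in> bowen_ball N f s x \<epsilon> T \<longleftrightarrow> (\<forall>t\<in>{s..s+T}. N (flow f t s y - flow f t s x) < \<epsilon>)"
proof -
  let ?g = "\<lambda>t. N (flow f t s y - flow f t s x)"
  have "continuous_on UNIV N" using is_norm_bounds[OF norm_N] by metis
  then have "continuous_on {s..s+T} ?g"
    by (rule continuous_on_compose2) (auto intro!: continuous_intros flow_continuous_on assms)
  then have compact: "compact (?g ` {s..s+T})" by (intro compact_continuous_image) auto
  have bdd: "bdd_above (?g ` {s..s+T})"
    using compact by (intro bounded_imp_bdd_above compact_imp_bounded)
  have "Sup (?g ` {s..s+T}) \<in> ?g ` {s..s+T}"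
    using assms bdd compact by (intro closed_contains_Sup compact_imp_closed) simp_all
  then have attained: "\<exists>t\<in>{s..s+T}. Sup (?g ` {s..s+T}) = ?g t"
    by (simp only: image_iff)
  show ?thesis
    unfolding bowen_ball_def mem_Collect_eq
  proof
    assume "Sup (?g ` {s..s+T}) < \<epsilon>"
    then show "\<forall>t\<in>{s..s+T}. ?g t < \<epsilon>"
      using cSUP_upper[OF _ bdd] by (meson le_less_trans)
  next
    assume "\<forall>t\<in>{s..s+T}. ?g t < \<epsilon>"
    with attained show "Sup (?g ` {s..s+T}) < \<epsilon>" by metis
  qed
qed

text \<open>By continuous dependence each Bowen ball contains a Euclidean ball about its centre;
  finitely many of these cover the compact set.\<close>

lemma finite_spanning_set_exists:
  assumes s: "t0 \<le> s" and T: "0 \<le> T" and L: "compact L" and \<epsilon>: "0 < \<epsilon>"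
  obtains E where "finite E" "spanning_set N f s \<epsilon> T L E"
proof -
  obtain C where C: "C > 0" "\<And>x. N x \<le> C * norm x" using is_norm_bounds[OF norm_N] by metis
  have "\<exists>r>0. ball x r \<subseteq> bowen_ball N f s x \<epsilon> T" for x
  proof -
    obtain d A where d: "d > 0" and A: "A > 0"
      and dep: "\<And>y t. norm (y - x) < d \<Longrightarrow> t \<in> {s..s+T} \<Longrightarrow>
        norm (flow f t s y - flow f t s x) \<le> A * norm (y - x)"
      using continuous_dependence[OF s solution_flow[OF s], where b = "s + T"] solution_flow[OF s]
      by metis
    \<comment> \<open>The first bound makes the dependence estimate applicable; the second absorbs
      its factor \<open>A\<close> and the factor \<open>C\<close> from passing to
      \<open>N\<close>.\<close>
    let ?r = "min d (\<epsilon> / (C * A))"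
    have "y \<in> bowen_ball N f s x \<epsilon> T" if "y \<in> ball x ?r" for y
      unfolding mem_bowen_ball_iff[OF s T]
    proof
      fix t assume t: "t \<in> {s..s+T}"
      have y: "norm (y - x) < d" "norm (y - x) < \<epsilon> / (C * A)"
        using that by (auto simp: dist_norm norm_minus_commute)
      have "N (flow f t s y - flow f t s x) \<le> C * norm (flow f t s y - flow f t s x)"
        by (rule C)
      also have "\<dots> \<le> C * (A * norm (y - x))"
        using dep[OF y(1) t] C(1) by (intro mult_left_mono) auto
      also have "\<dots> < \<epsilon>" using y(2) C(1) A by (simp add: field_simps)
      finally show "N (flow f t s y - flow f t s x) < \<epsilon>" .
    qed
    moreover have "?r > 0" using d \<epsilon> C A by simp
    ultimately show ?thesis by blast
  qed
  then obtain r where r: "\<And>x. r x > 0" "\<And>x. ball x (r x) \<subseteq> bowen_ball N f s x \<epsilon> T"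
    by metis
  have "L \<subseteq> (\<Union>x\<in>L. ball x (r x))" using r(1) by auto
  then obtain E where "E \<subseteq> L" "finite E" "L \<subseteq> (\<Union>x\<in>E. ball x (r x))"
    using compactE_image[OF L, of L "\<lambda>x. ball x (r x)"] by auto
  then show thesis using that[of E] r(2) by (fastforce simp: spanning_set_def)
qed

end

lemma min_spanning_card_le:
  "finite E \<Longrightarrow> spanning_set N f s \<epsilon> T L E \<Longrightarrow> min_spanning_card N f s \<epsilon> T L \<le> card E"
  unfolding min_spanning_card_def by (rule Least_le) blast

text \<open>Some finite spanning set must be supplied, since \<open>LEAST\<close> over an empty set
  of cardinalities has no useful value.\<close>

lemma min_spanning_card_attained:
  assumes "finite E" "spanning_set N f s \<epsilon> T L E"
  obtains E' where "finite E'" "card E' = min_spanning_card N f s \<epsilon> T L" "spanning_set N f s \<epsilon> T L E'"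
  using LeastI[of "\<lambda>k. \<exists>E. finite E \<and> card E = k \<and> spanning_set N f s \<epsilon> T L E"] assms
  unfolding min_spanning_card_def by blast

text \<open>The convention \<open>ln 0 = 0\<close> makes this hold for \<open>m = 0\<close> as
  well.\<close>

lemma ln_of_nat_mono: "m \<le> n \<Longrightarrow> ln (real m) \<le> ln (real n)"
  by (cases "m = 0"; cases "n = 0") auto

section \<open>Comparing spanning sets at two initial times\<close>

context normed_forward_complete_system
begin

lemma spanning_set_mono:
  assumes "t0 \<le> s" "0 \<le> T" "T \<le> T'" "\<epsilon>' \<le> \<epsilon>" "spanning_set N f s \<epsilon>' T' L E"
  shows "spanning_set N f s \<epsilon> T L E"
proof -
  have "bowen_ball N f s x \<epsilon>' T' \<subseteq> bowen_ball N f s x \<epsilon> T" for x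
  proof
    fix y assume "y \<in> bowen_ball N f s x \<epsilon>' T'"
    then have "\<forall>t\<in>{s..s+T'}. N (flow f t s y - flow f t s x) < \<epsilon>'"
      using assms(1-3) by (simp add: mem_bowen_ball_iff)
    then show "y \<in> bowen_ball N f s x \<epsilon> T"
      unfolding mem_bowen_ball_iff[OF assms(1,2)] using assms(3,4)
      by (meson add_left_mono atLeastAtMost_iff less_le_trans order_trans)
  qed
  then show ?thesis using assms(5) unfolding spanning_set_def by blast
qed

text \<open>By \<open>flow_flow\<close>, the window \<open>{r..r+T}\<close> is the tail of the
  window of length \<open>T + (r - s)\<close> starting at \<open>s\<close>, so closeness on the long
  window implies closeness on the tail.\<close>

lemma spanning_set_reachable:
  assumes r: "t0 \<le> s" "s \<le> r" and T: "0 \<le> T"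
    and E: "spanning_set N f s \<epsilon> (T + (r - s)) K E"
  shows "spanning_set N f r \<epsilon> T (reachable_set f r s K) (reachable_set f r s E)"
proof -
  have "flow f r s y \<in> bowen_ball N f r (flow f r s x) \<epsilon> T"
    if "y \<in> bowen_ball N f s x \<epsilon> (T + (r - s))" for x y
    using that r T by (auto simp: mem_bowen_ball_iff flow_flow)
  then show ?thesis using E unfolding spanning_set_def reachable_set_def by blast
qed

text \<open>A finite spanning set with \<open>\<epsilon> = 1\<close> puts every trajectory from
  \<open>K\<close> within \<open>N\<close>-distance 1 of one of finitely many compact arcs.\<close>

lemma bounded_trajectories:
  assumes s: "t0 \<le> s" "s \<le> r" and K: "compact K"
  obtains R where "\<And>x t. x \<in> K \<Longrightarrow> t \<in> {s..r} \<Longrightarrow> norm (flow f t s x) \<le> R"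
proof -
  obtain c where c: "c > 0" "\<And>x. c * norm x \<le> N x" using is_norm_bounds[OF norm_N] by metis
  obtain E where E: "finite E" "spanning_set N f s 1 (r - s) K E"
    using finite_spanning_set_exists[of s "r - s" K 1] s K by auto
  have "compact (\<Union>x\<in>E. (\<lambda>t. flow f t s x) ` {s..r})"
    using E(1) s by (intro compact_UN compact_continuous_image flow_continuous_on) auto
  then obtain R where R: "\<And>x t. x \<in> E \<Longrightarrow> t \<in> {s..r} \<Longrightarrow> norm (flow f t s x) \<le> R"
    by (force dest!: compact_imp_bounded simp: bounded_iff)
  show thesis
  proof
    fix y t assume y: "y \<in> K" and t: "t \<in> {s..r}"
    then obtain x where x: "x \<in> E" "y \<in> bowen_ball N f s x 1 (r - s)"
      using E(2) by (auto simp: spanning_set_def)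
    then have "N (flow f t s y - flow f t s x) < 1"
      using t s by (auto simp: mem_bowen_ball_iff)
    then have "norm (flow f t s y - flow f t s x) \<le> 1 / c"
      using c(2)[of "flow f t s y - flow f t s x"] c(1) by (simp add: field_simps)
    then show "norm (flow f t s y) \<le> R + 1 / c"
      using R[OF x(1) t] norm_triangle_sub[of "flow f t s y" "flow f t s x"] by simp
  qed
qed

lemma backward_estimate:
  assumes s: "t0 \<le> s" "s \<le> r" and K: "compact K"
  obtains A where "A \<ge> 1"
    "\<And>x y t. x \<in> K \<Longrightarrow> y \<in> K \<Longrightarrow> t \<in> {s..r} \<Longrightarrow>
      N (flow f t s y - flow f t s x) \<le> A * N (flow f r s y - flow f r s x)"
proof -
  obtain c C where c: "c > 0" "\<And>x. c * norm x \<le> N x" and C: "C > 0" "\<And>x. N x \<le> C * norm x"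
    using is_norm_bounds[OF norm_N] by metis
  obtain R where R: "\<And>x t. x \<in> K \<Longrightarrow> t \<in> {s..r} \<Longrightarrow> norm (flow f t s x) \<le> R"
    using bounded_trajectories[OF s K] by blast
  obtain M where M: "M \<ge> 0"
    and lip: "\<And>t x y. t \<in> {t0..r} \<Longrightarrow> x \<in> cball 0 R \<Longrightarrow> y \<in> cball 0 R \<Longrightarrow>
      norm (f t x - f t y) \<le> M * norm (x - y)"
    using lipschitz_on_cball[of r R] by blast
  \<comment> \<open>The exponential is the backward Gronwall factor, and \<open>C / c\<close> pays
    for passing from \<open>N\<close> to the Euclidean norm and back. The maximum with 1 ensures
    \<open>\<epsilon> / A \<le> \<epsilon>\<close> later.\<close>
  define A where "A = max 1 (C * exp (M * (r - s)) / c)"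
  show thesis
  proof (rule that[of A])
    show "A \<ge> 1" by (simp add: A_def)
    fix x y t assume xy: "x \<in> K" "y \<in> K" and t: "t \<in> {s..r}"
    let ?D = "\<lambda>t. flow f t s y - flow f t s x"
    have "norm (?D t) \<le> norm (?D r) * exp (M * (r - t))"
      by (rule solution_from_distance(2)[OF solution_flow solution_flow, where X = "cball 0 R"])
        (use s lip M R xy t in auto)
    also have "\<dots> \<le> norm (?D r) * exp (M * (r - s))"
      using t M by (intro mult_left_mono) (auto intro: mult_left_mono)
    also have "\<dots> \<le> N (?D r) / c * exp (M * (r - s))"
      using c by (intro mult_right_mono) (auto simp: field_simps)
    finally have "C * norm (?D t) \<le> C * (N (?D r) / c * exp (M * (r - s)))"
      using C(1) by (intro mult_left_mono) auto
    also have "\<dots> = C * exp (M * (r - s)) / c * N (?D r)" by simp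
    also have "\<dots> \<le> A * N (?D r)"
    proof (rule mult_right_mono)
      show "0 \<le> N (?D r)" using c(2)[of "?D r"] c(1) by (meson less_imp_le mult_nonneg_nonneg norm_ge_zero order_trans)
    qed (simp add: A_def)
    finally show "N (?D t) \<le> A * N (?D r)" using C(2)[of "?D t"] by linarith
  qed
qed

lemma min_spanning_card_mono:
  assumes "t0 \<le> s" "0 \<le> T" "T \<le> T'" "\<epsilon>' \<le> \<epsilon>"
    and E: "finite E" "spanning_set N f s \<epsilon>' T' L E"
  shows "min_spanning_card N f s \<epsilon> T L \<le> min_spanning_card N f s \<epsilon>' T' L"
proof -
  obtain E' where "finite E'" "card E' = min_spanning_card N f s \<epsilon>' T' L" "spanning_set N f s \<epsilon>' T' L E'"
    by (rule min_spanning_card_attained[OF E])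
  then show ?thesis using min_spanning_card_le spanning_set_mono assms by metis
qed

lemma min_spanning_card_reachable_le:
  assumes r: "t0 \<le> s" "s \<le> r" and T: "0 \<le> T" and "compact K" "0 < \<epsilon>"
  shows "min_spanning_card N f r \<epsilon> T (reachable_set f r s K)
    \<le> min_spanning_card N f s \<epsilon> (T + (r - s)) K"
proof -
  obtain E0 where E0: "finite E0" "spanning_set N f s \<epsilon> (T + (r - s)) K E0"
    using finite_spanning_set_exists[of s "T + (r - s)" K \<epsilon>] assms by auto
  then obtain E where E: "finite E" "card E = min_spanning_card N f s \<epsilon> (T + (r - s)) K"
    "spanning_set N f s \<epsilon> (T + (r - s)) K E"
    using min_spanning_card_attained[OF E0] by metis
  have "min_spanning_card N f r \<epsilon> T (reachable_set f r s K) \<le> card (reachable_set f r s E)"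
    using spanning_set_reachable[OF r T E(3)] E(1)
    by (intro min_spanning_card_le) (auto simp: reachable_set_def)
  also have "\<dots> \<le> card E" unfolding reachable_set_def using E(1) by (rule card_image_le)
  finally show ?thesis using E(2) by simp
qed

text \<open>Obtained by pushing forward a spanning set of \<open>K\<close>, so only compactness of
  \<open>K\<close> enters.\<close>

lemma finite_spanning_set_reachable_exists:
  assumes r: "t0 \<le> s" "s \<le> r" and T: "0 \<le> T" and "compact K" "0 < \<epsilon>"
  obtains E where "finite E" "spanning_set N f r \<epsilon> T (reachable_set f r s K) E"
proof -
  obtain E where "finite E" "spanning_set N f s \<epsilon> (T + (r - s)) K E"
    using finite_spanning_set_exists[of s "T + (r - s)" K \<epsilon>] assms by auto
  then show thesis
    using that[of "reachable_set f r s E"] spanning_set_reachable[OF r T]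
    by (auto simp: reachable_set_def)
qed

lemma min_spanning_card_le_reachable:
  assumes r: "t0 \<le> s" "s \<le> r" and K: "compact K"
  obtains A where "A \<ge> 1"
    "\<And>\<epsilon> T. 0 < \<epsilon> \<Longrightarrow> 0 \<le> T \<Longrightarrow> min_spanning_card N f s \<epsilon> T K
      \<le> min_spanning_card N f r (\<epsilon> / A) T (reachable_set f r s K)"
proof -
  obtain A where A: "A \<ge> 1"
    and est: "\<And>x y t. x \<in> K \<Longrightarrow> y \<in> K \<Longrightarrow> t \<in> {s..r} \<Longrightarrow>
      N (flow f t s y - flow f t s x) \<le> A * N (flow f r s y - flow f r s x)"
    using backward_estimate[OF r K] by blast
  show thesis
  proof (rule that[OF A])
    fix \<epsilon> T :: real assume \<epsilon>: "0 < \<epsilon>" and T: "0 \<le> T"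
    let ?L = "reachable_set f r s K"
    have "0 < \<epsilon> / A" using \<epsilon> A by simp
    then obtain E1 where E1: "finite E1" "card E1 = min_spanning_card N f r (\<epsilon> / A) T ?L"
      "spanning_set N f r (\<epsilon> / A) T ?L E1"
      using finite_spanning_set_reachable_exists[OF r T K] min_spanning_card_attained by metis
    then have "E1 \<subseteq> flow f r s ` K" by (simp add: spanning_set_def reachable_set_def)
    \<comment> \<open>Choosing one preimage in \<open>K\<close> for each point of \<open>E1\<close>
      preserves the cardinality.\<close>
    then obtain E where E: "E \<subseteq> K" "finite E" "E1 = flow f r s ` E" "card E = card E1"
      using E1(1) by (metis finite_subset_image card_image subset_image_inj finite_imageD)
    have "spanning_set N f s \<epsilon> (T + (r - s)) K E"
      unfolding spanning_set_def
    proof (intro conjI subsetI)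
      fix y assume y: "y \<in> K"
      then have "flow f r s y \<in> ?L" by (simp add: reachable_set_def)
      then obtain x where x: "x \<in> E" "flow f r s y \<in> bowen_ball N f r (flow f r s x) (\<epsilon> / A) T"
        using E1(3) E(3) by (auto simp: spanning_set_def)
      have late: "N (flow f t s y - flow f t s x) < \<epsilon> / A" if "t \<in> {r..r+T}" for t
        using x(2) that r T by (auto simp: mem_bowen_ball_iff flow_flow)
      \<comment> \<open>Up to time \<open>r\<close> the backward estimate bounds the distance by
        \<open>A\<close> times its value at \<open>r\<close>, which is below
        \<open>\<epsilon> / A\<close>; from \<open>r\<close> on, \<open>late\<close> suffices
        because \<open>A \<ge> 1\<close>.\<close>
      have "N (flow f t s y - flow f t s x) < \<epsilon>" if "t \<in> {s..s+(T+(r-s))}" for t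
      proof (cases "t \<le> r")
        case True
        then have "N (flow f t s y - flow f t s x) \<le> A * N (flow f r s y - flow f r s x)"
          using x(1) y E(1) that by (intro est) auto
        also have "\<dots> < \<epsilon>" using late[of r] T A by (simp add: field_simps)
        finally show ?thesis .
      next
        case False
        then have "N (flow f t s y - flow f t s x) < \<epsilon> / A" using that by (intro late) auto
        also have "\<dots> \<le> \<epsilon>" using \<epsilon> A by (simp add: field_simps)
        finally show ?thesis .
      qed
      then have "y \<in> bowen_ball N f s x \<epsilon> (T + (r - s))"
        using r T by (simp add: mem_bowen_ball_iff)
      then show "y \<in> (\<Union>x\<in>E. bowen_ball N f s x \<epsilon> (T + (r - s)))" using x(1) by blast
    qed (use E(1) in auto)
    \<comment> \<open>The pulled-back set spans for the longer duration; cutting back to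
      \<open>T\<close> leaves only the factor \<open>A\<close> as a loss.\<close>
    then have "spanning_set N f s \<epsilon> T K E"
      by (rule spanning_set_mono[rotated -1]) (use r T in auto)
    then show "min_spanning_card N f s \<epsilon> T K \<le> min_spanning_card N f r (\<epsilon> / A) T ?L"
      using min_spanning_card_le E(2,4) E1(2) by metis
  qed
qed

end

section \<open>Growth rates\<close>

text \<open>The inner limsup of \<open>topological_entropy\<close> for a fixed
  \<open>\<epsilon>\<close>, detached from the dynamics.\<close>

definition growth_rate :: "(real \<Rightarrow> nat) \<Rightarrow> ereal" where
  "growth_rate a = Limsup at_top (\<lambda>T. ereal (1 / T * ln (real (a T))))"

lemma growth_rate_mono:
  assumes "\<And>T. 0 \<le> T \<Longrightarrow> a T \<le> b T"
  shows "growth_rate a \<le> growth_rate b"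
  unfolding growth_rate_def
proof (rule Limsup_mono)
  show "\<forall>\<^sub>F T in at_top. ereal (1 / T * ln (real (a T))) \<le> ereal (1 / T * ln (real (b T)))"
    using eventually_gt_at_top[of 0]
  proof eventually_elim
    case (elim T)
    then show ?case
      using ln_of_nat_mono[OF assms[of T]] by (auto intro!: mult_left_mono divide_right_mono)
  qed
qed

text \<open>The rates over \<open>T\<close> and \<open>T + \<tau>\<close> differ by the factor
  \<open>1 + \<tau> / T\<close>, which tends to 1.\<close>

lemma growth_rate_shift_le: "growth_rate (\<lambda>T. a (T + \<tau>)) \<le> growth_rate a"
  unfolding growth_rate_def[of "\<lambda>T. a (T + \<tau>)"] Limsup_le_iff
proof (intro allI impI)
  fix y assume "growth_rate a < y"
  \<comment> \<open>The real \<open>c\<close> eventually bounds the rate of \<open>a\<close>, and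
    the gap between \<open>c\<close> and \<open>d\<close> absorbs the factor
    \<open>1 + \<tau> / T\<close>, whatever the sign of \<open>c\<close>.\<close>
  then obtain c where c: "growth_rate a < ereal c" "ereal c < y"
    using ereal_dense2 by blast
  obtain d where d: "ereal c < ereal d" "ereal d < y" using c(2) ereal_dense2 by blast
  have "\<forall>\<^sub>F T in at_top. ereal (1 / T * ln (real (a T))) < ereal c"
    using c(1) unfolding growth_rate_def by (rule Limsup_lessD)
  moreover have "filterlim (\<lambda>T. T + \<tau>) at_top (at_top :: real filter)"
    by (rule filterlim_at_top_mono[OF filterlim_tendsto_add_at_top[OF tendsto_const[of \<tau>] filterlim_ident]]) auto
  ultimately have 1: "\<forall>\<^sub>F T in at_top. ereal (1 / (T + \<tau>) * ln (real (a (T + \<tau>)))) < ereal c"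
    by (rule eventually_compose_filterlim)
  have "((\<lambda>T::real. c * (1 + \<tau> / T)) \<longlongrightarrow> c * (1 + 0)) at_top"
    by (intro tendsto_intros tendsto_divide_0[OF tendsto_const] filterlim_at_top_imp_at_infinity filterlim_ident)
  then have 2: "\<forall>\<^sub>F T in at_top. c * (1 + \<tau> / T) < d"
    using d(1) by (intro order_tendstoD(2)) auto
  \<comment> \<open>Both \<open>T\<close> and \<open>T + \<tau>\<close> are eventually positive, so
    the denominators can be cleared.\<close>
  show "\<forall>\<^sub>F T in at_top. ereal (1 / T * ln (real (a (T + \<tau>)))) < y"
    using 1 2 eventually_gt_at_top[of 0] eventually_gt_at_top[of "- \<tau>"]
  proof eventually_elim
    case (elim T)
    then have "ln (real (a (T + \<tau>))) < c * (T + \<tau>)" by (simp add: field_simps)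
    then have "1 / T * ln (real (a (T + \<tau>))) < c * (1 + \<tau> / T)"
      using elim by (simp add: field_simps)
    with elim have "1 / T * ln (real (a (T + \<tau>))) < d" by linarith
    then show ?case using d(2) by (metis ereal_less_eq(3) le_less_trans less_imp_le)
  qed
qed

text \<open>A level below the supremum is exceeded at some \<open>x > 0\<close>, hence on all of
  \<open>(0, x)\<close> by antitonicity.\<close>

lemma tendsto_at_right_SUP_antimono:
  fixes G :: "real \<Rightarrow> ereal"
  assumes anti: "\<And>x y. 0 < x \<Longrightarrow> x \<le> y \<Longrightarrow> G y \<le> G x"
  shows "(G \<longlongrightarrow> (SUP x\<in>{0<..}. G x)) (at_right 0)"
proof (rule order_tendstoI)
  fix l assume "l < (SUP x\<in>{0<..}. G x)"
  then obtain x where x: "x > 0" "l < G x" by (auto simp: less_SUP_iff)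
  have "\<forall>\<^sub>F y in at_right 0. y < x" "\<forall>\<^sub>F y in at_right (0::real). 0 < y"
    using x(1) by (auto simp: eventually_at_right_less intro: eventually_at_rightI)
  then show "\<forall>\<^sub>F y in at_right 0. l < G y"
    by eventually_elim (use x anti in \<open>auto intro: less_le_trans\<close>)
next
  fix u assume u: "(SUP x\<in>{0<..}. G x) < u"
  show "\<forall>\<^sub>F y in at_right 0. G y < u"
    using eventually_at_right_less[of 0]
    by eventually_elim (use u in \<open>auto intro: le_less_trans[OF SUP_upper]\<close>)
qed

section \<open>Entropy as a supremum over \<open>\<epsilon>\<close>, and its invariance\<close>

context normed_forward_complete_system
begin

text \<open>A smaller \<open>\<epsilon>\<close> requires at least as many points, so the growth rate
  is antitone in \<open>\<epsilon>\<close> and its limit at \<open>0\<close> is a supremum.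
  Existence of spanning sets is a premise so that \<open>L\<close> may be a reachable set.\<close>

lemma topological_entropy_eq_SUP:
  assumes s: "t0 \<le> s"
    and ex: "\<And>\<epsilon> T. 0 < \<epsilon> \<Longrightarrow> 0 \<le> T \<Longrightarrow> \<exists>E. finite E \<and> spanning_set N f s \<epsilon> T L E"
  shows "topological_entropy N f s L
    = (SUP \<epsilon>\<in>{0<..}. growth_rate (\<lambda>T. min_spanning_card N f s \<epsilon> T L))"
  unfolding topological_entropy_def growth_rate_def[symmetric]
proof (rule tendsto_Lim)
  show "((\<lambda>\<epsilon>. growth_rate (\<lambda>T. min_spanning_card N f s \<epsilon> T L)) \<longlongrightarrow>
      (SUP \<epsilon>\<in>{0<..}. growth_rate (\<lambda>T. min_spanning_card N f s \<epsilon> T L))) (at_right 0)"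
  proof (intro tendsto_at_right_SUP_antimono growth_rate_mono)
    fix \<delta> \<epsilon> T :: real assume "0 < \<delta>" "\<delta> \<le> \<epsilon>" "0 \<le> T"
    then show "min_spanning_card N f s \<epsilon> T L \<le> min_spanning_card N f s \<delta> T L"
      using ex[of \<delta> T] min_spanning_card_mono[OF s] by blast
  qed
qed simp

lemma topological_entropy_reachable_set:
  assumes r: "t0 \<le> s" "s \<le> r" and K: "compact K"
  shows "topological_entropy N f s K = topological_entropy N f r (reachable_set f r s K)"
proof -
  let ?L = "reachable_set f r s K"
  define G where "G \<epsilon> = growth_rate (\<lambda>T. min_spanning_card N f s \<epsilon> T K)" for \<epsilon>
  define H where "H \<epsilon> = growth_rate (\<lambda>T. min_spanning_card N f r \<epsilon> T ?L)" for \<epsilon>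
  have "topological_entropy N f s K = (SUP \<epsilon>\<in>{0<..}. G \<epsilon>)"
    unfolding G_def using finite_spanning_set_exists[OF r(1) _ K]
    by (intro topological_entropy_eq_SUP r) metis
  moreover have "topological_entropy N f r ?L = (SUP \<epsilon>\<in>{0<..}. H \<epsilon>)"
    unfolding H_def using finite_spanning_set_reachable_exists[OF r _ K] r
    by (intro topological_entropy_eq_SUP) (linarith, metis)
  moreover have "(SUP \<epsilon>\<in>{0<..}. H \<epsilon>) \<le> (SUP \<epsilon>\<in>{0<..}. G \<epsilon>)"
  proof (rule SUP_mono)
    fix \<epsilon> :: real assume "\<epsilon> \<in> {0<..}"
    then have "H \<epsilon> \<le> growth_rate (\<lambda>T. min_spanning_card N f s \<epsilon> (T + (r - s)) K)"
      unfolding H_def using min_spanning_card_reachable_le[OF r _ K] by (intro growth_rate_mono) auto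
    also have "\<dots> \<le> G \<epsilon>" unfolding G_def by (rule growth_rate_shift_le)
    finally show "\<exists>\<delta>\<in>{0<..}. H \<epsilon> \<le> G \<delta>" using \<open>\<epsilon> \<in> {0<..}\<close> by blast
  qed
  moreover have "(SUP \<epsilon>\<in>{0<..}. G \<epsilon>) \<le> (SUP \<epsilon>\<in>{0<..}. H \<epsilon>)"
  \<comment> \<open>Rescaling by \<open>1 / A\<close> maps the positive reals into themselves, so
    the factor \<open>A\<close> is invisible to the supremum over all
    \<open>\<epsilon> > 0\<close>.\<close>
  proof -
    obtain A where A: "A \<ge> 1"
      "\<And>\<epsilon> T. 0 < \<epsilon> \<Longrightarrow> 0 \<le> T \<Longrightarrow> min_spanning_card N f s \<epsilon> T K \<le> min_spanning_card N f r (\<epsilon> / A) T ?L"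
      using min_spanning_card_le_reachable[OF r K] by blast
    then have "G \<epsilon> \<le> H (\<epsilon> / A)" if "0 < \<epsilon>" for \<epsilon>
      unfolding G_def H_def using that by (intro growth_rate_mono) auto
    moreover have "\<epsilon> / A \<in> {0<..}" if "\<epsilon> \<in> {0<..}" for \<epsilon> using that A(1) by simp
    ultimately show ?thesis by (intro SUP_mono) (metis greaterThan_iff)
  qed
  ultimately show ?thesis by simp
qed

end

theorem lemma3:
  fixes f :: "real \<Rightarrow> real ^ 'n \<Rightarrow> real ^ 'n"
    and N :: "real ^ 'n \<Rightarrow> real"
    and t0 :: real
    and K :: "(real ^ 'n) set"
  assumes "is_norm N"
    and "piecewise_continuous_in_time t0 f"
    and "continuously_differentiable_in_state t0 f"
    and "forward_complete t0 f"
    and "compact K"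
    and "interior K \<noteq> {}"
  shows "\<forall>t1\<ge>t0. topological_entropy N f t0 K
                 = topological_entropy N f t1 (reachable_set f t1 t0 K)"
proof -
  interpret normed_forward_complete_system f t0 N
    using assms by unfold_locales
  show ?thesis using topological_entropy_reachable_set assms(5) by blast
qed

end
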